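(* For every $n\ge 1$ and every $\mathcal{L}=(L_1,\dots,L_n)$ with $L_i\subseteq[n]$, \[\mathrm{SP}(n,\mathcal{L})=\prod_{i=1}^n\left(\sum_{\ell\in L_i}\left(\binom{n}{\ell}-\binom{i-1}{\ell}\right)\right).\]
   Context: Let $[n]=\{1,\dots,n\}$, $\mathcal{S}_n$ the permutations of $[n]$ in one-line notation, and $\pi_i^{-1}$ the position $j$ with $\pi_j=i$. A tuple $(C_1,\dots,C_n)$ of non-empty subsets of $[n]$ is a subset parking function with outcome $\pi\in\mathcal{S}_n$ if for every $1\le i\le n$, $\pi_i^{-1}$ is the smallest element of $C_i\setminus\{\pi_{i'}^{-1}:i'<i\}$. It is an $\mathcal{L}$-parking function if it is a subset parking function (with some outcome) and $|C_i|\in L_i$ for all $i$. $\mathrm{SP}(n,\mathcal{L})$ is the number of $\mathcal{L}$-parking functions. Convention: $\binom{a}{\ell}=0$ for $\ell>a$. *)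

theory Defs
  imports "HOL-Library.FuncSet" "HOL-Combinatorics.Permutations"
begin

text \<open>
  Tuples indexed by \<open>{1..n}\<close> are functions on \<open>nat\<close>. Those that are counted are extensional
  (\<open>\<rightarrow>\<^sub>E\<close>), so that each tuple is represented by exactly one function.
\<close>

definition subset_tuples :: "nat \<Rightarrow> (nat \<Rightarrow> nat set) set" where
  "subset_tuples n = {1..n} \<rightarrow>\<^sub>E {S. S \<subseteq> {1..n} \<and> S \<noteq> {}}"

text \<open>
  \<open>inv \<pi> i\<close> is the position \<open>j\<close> with \<open>\<pi> j = i\<close>. Being the smallest element is stated
  relationally rather than via \<open>Min\<close> because the set of available positions may be empty.
\<close>

definition parking_outcome :: "nat \<Rightarrow> (nat \<Rightarrow> nat set) \<Rightarrow> (nat \<Rightarrow> nat) \<Rightarrow> bool" where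
  "parking_outcome n C \<pi> \<longleftrightarrow>
     \<pi> permutes {1..n} \<and>
     (\<forall>i\<in>{1..n}. let A = C i - {inv \<pi> i' |i'. i' \<in> {1..n} \<and> i' < i}
                 in inv \<pi> i \<in> A \<and> (\<forall>j\<in>A. inv \<pi> i \<le> j))"

definition subset_parking_function :: "nat \<Rightarrow> (nat \<Rightarrow> nat set) \<Rightarrow> bool" where
  "subset_parking_function n C \<longleftrightarrow> C \<in> subset_tuples n \<and> (\<exists>\<pi>. parking_outcome n C \<pi>)"

definition L_parking_function :: "nat \<Rightarrow> (nat \<Rightarrow> nat set) \<Rightarrow> (nat \<Rightarrow> nat set) \<Rightarrow> bool" where
  "L_parking_function n L C \<longleftrightarrow>
     subset_parking_function n C \<and> (\<forall>i\<in>{1..n}. card (C i) \<in> L i)"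

definition SP :: "nat \<Rightarrow> (nat \<Rightarrow> nat set) \<Rightarrow> nat" where
  "SP n L = card {C. L_parking_function n L C}"

lemma finite_L_parking_functions: "finite {C. L_parking_function n L C}"
proof (rule finite_subset)
  show "{C. L_parking_function n L C} \<subseteq> subset_tuples n"
    by (auto simp: L_parking_function_def subset_parking_function_def)
  show "finite (subset_tuples n)"
    unfolding subset_tuples_def by (intro finite_PiE) auto
qed

end

theory Submission
  imports Defs
begin

text \<open>
  Cars park greedily: car \<open>i\<close> takes the smallest free spot of \<open>C i\<close>, and the tuple is a
  parking function iff no car finds all of its preferred spots occupied. When car \<open>i\<close> arrives,
  exactly \<open>i - 1\<close> spots are taken, whatever the earlier choices were. So among the sets of size
  \<open>l\<close>, exactly \<open>(i - 1) choose l\<close> are bad for car \<open>i\<close>, and the count factorises.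
\<close>

text \<open>\<open>Min\<close> of an empty set is an unspecified number, so the result is the true
  set of taken spots only while no car has failed; hence the \<open>all_park\<close> hypotheses
  below.\<close>

fun occupied :: "(nat \<Rightarrow> nat set) \<Rightarrow> nat \<Rightarrow> nat set" where
  "occupied C 0 = {}"
| "occupied C (Suc m) = insert (Min (C (Suc m) - occupied C m)) (occupied C m)"

definition spot :: "(nat \<Rightarrow> nat set) \<Rightarrow> nat \<Rightarrow> nat" where
  "spot C i = Min (C i - occupied C (i - 1))"

text \<open>Non-containment is the form counted by \<open>card_subsets_not_within\<close>, and it
  already forces each \<open>C i\<close> to be non-empty.\<close>

definition all_park :: "(nat \<Rightarrow> nat set) \<Rightarrow> nat \<Rightarrow> bool" where
  "all_park C m \<longleftrightarrow> (\<forall>i\<in>{1..m}. \<not> C i \<subseteq> occupied C (i - 1))"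

lemma occupied_eq_spots: "occupied C m = spot C ` {1..m}"
  by (induction m) (simp_all add: spot_def atLeastAtMostSuc_conv)

text \<open>Allows the set of car \<open>m + 1\<close> to be replaced without disturbing the first
  \<open>m\<close> cars.\<close>

lemma occupied_cong:
  "(\<And>i. i \<in> {1..m} \<Longrightarrow> C i = D i) \<Longrightarrow> occupied C m = occupied D m"
  by (induction m) auto

lemma all_park_Suc: "all_park C (Suc m) \<longleftrightarrow> all_park C m \<and> \<not> C (Suc m) \<subseteq> occupied C m"
  by (auto simp: all_park_def atLeastAtMostSuc_conv)

lemma all_park_cong:
  assumes "\<And>i. i \<in> {1..m} \<Longrightarrow> C i = D i"
  shows "all_park C m \<longleftrightarrow> all_park D m"
  unfolding all_park_def
proof (intro ball_cong refl)
  fix i assume i: "i \<in> {1..m}"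
  have "occupied C (i - 1) = occupied D (i - 1)"
    using i by (intro occupied_cong assms) auto
  then show "(\<not> C i \<subseteq> occupied C (i - 1)) = (\<not> D i \<subseteq> occupied D (i - 1))"
    using assms[OF i] by simp
qed

lemma spot_in:
  assumes "all_park C m" "i \<in> {1..m}" "finite (C i)"
  shows "spot C i \<in> C i - occupied C (i - 1)"
  unfolding spot_def using assms by (intro Min_in) (auto simp: all_park_def)

lemma inj_on_spot:
  assumes "all_park C m" "\<And>i. i \<in> {1..m} \<Longrightarrow> finite (C i)"
  shows "inj_on (spot C) {1..m}"
proof (rule linorder_inj_onI')
  fix i j assume ij: "i \<in> {1..m}" "j \<in> {1..m}" "i < j"
  then have "spot C i \<in> occupied C (j - 1)"
    by (auto simp: occupied_eq_spots)
  moreover have "spot C j \<notin> occupied C (j - 1)"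
    using spot_in[OF assms(1) ij(2) assms(2)] ij by auto
  ultimately show "spot C i \<noteq> spot C j" by auto
qed

text \<open>The outcome is forced: inductively \<open>inv \<pi>\<close> makes the greedy choices, so
  \<open>inv \<pi> i\<close> itself witnesses that car \<open>i\<close> finds a free spot.\<close>

lemma parking_outcome_imp_all_park:
  assumes out: "parking_outcome n C \<pi>" and fin: "\<And>i. i \<in> {1..n} \<Longrightarrow> finite (C i)"
  shows "all_park C n"
proof -
  have step: "inv \<pi> i \<in> C i - inv \<pi> ` {1..<i} \<and> (\<forall>j\<in>C i - inv \<pi> ` {1..<i}. inv \<pi> i \<le> j)"
    if "i \<in> {1..n}" for i
  proof -
    have "{inv \<pi> i' |i'. i' \<in> {1..n} \<and> i' < i} = inv \<pi> ` {1..<i}"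
      using that by auto
    moreover from out that
    have "let A = C i - {inv \<pi> i' |i'. i' \<in> {1..n} \<and> i' < i}
      in inv \<pi> i \<in> A \<and> (\<forall>j\<in>A. inv \<pi> i \<le> j)"
      unfolding parking_outcome_def by blast
    ultimately show ?thesis
      unfolding Let_def by metis
  qed
  have occ: "occupied C m = inv \<pi> ` {1..<Suc m}" if "m \<le> n" for m
    using that
  proof (induction m)
    case (Suc m)
    have i: "Suc m \<in> {1..n}" using Suc.prems by simp
    have "Min (C (Suc m) - inv \<pi> ` {1..<Suc m}) = inv \<pi> (Suc m)"
      using step[OF i] fin[OF i] by (intro Min_eqI) auto
    moreover have "{1..<Suc (Suc m)} = insert (Suc m) {1..<Suc m}" by auto
    ultimately show ?case using Suc by simp
  qed simp
  show ?thesis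
    unfolding all_park_def
  proof
    fix i assume i: "i \<in> {1..n}"
    then have "occupied C (i - 1) = inv \<pi> ` {1..<i}"
      using occ[of "i - 1"] by auto
    then show "\<not> C i \<subseteq> occupied C (i - 1)"
      using step[OF i] by auto
  qed
qed

text \<open>The greedy spots are \<open>n\<close> distinct elements of \<open>{1..n}\<close>, hence
  all of them. Since \<open>spot C\<close> sends cars to positions, the outcome is its
  inverse.\<close>

lemma all_park_imp_parking_outcome:
  assumes park: "all_park C n" and sub: "\<And>i. i \<in> {1..n} \<Longrightarrow> C i \<subseteq> {1..n}"
  shows "\<exists>\<pi>. parking_outcome n C \<pi>"
proof -
  have fin: "finite (C i)" if "i \<in> {1..n}" for i
    by (rule finite_subset[OF sub[OF that]]) simp
  \<comment> \<open>\<open>permutes\<close> demands the identity outside \<open>{1..n}\<close>,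
    where \<open>spot C\<close> is arbitrary.\<close>
  define p where "p i = (if i \<in> {1..n} then spot C i else i)" for i
  have "inj_on (spot C) {1..n}"
    using park fin by (rule inj_on_spot)
  moreover have "spot C ` {1..n} \<subseteq> {1..n}"
    using spot_in[OF park] fin sub by blast
  ultimately have "bij_betw (spot C) {1..n} {1..n}"
    by (simp add: bij_betw_def endo_inj_surj)
  then have "bij_betw p {1..n} {1..n}"
    by (rule bij_betw_cong[THEN iffD1, rotated]) (simp add: p_def)
  then have perm: "p permutes {1..n}"
    by (rule bij_imp_permutes) (simp only: p_def if_False)
  have inv: "inv (inv p) = p"
    using permutes_inv_inv[OF perm] .
  have "parking_outcome n C (inv p)"
    unfolding parking_outcome_def Let_def inv
  proof (intro conjI ballI)
    show "inv p permutes {1..n}"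
      using perm by (rule permutes_inv)
  next
    fix i assume i: "i \<in> {1..n}"
    have occ: "{p i' |i'. i' \<in> {1..n} \<and> i' < i} = occupied C (i - 1)"
      using i by (auto simp: occupied_eq_spots p_def)
    have pi: "p i = spot C i" using i by (simp add: p_def)
    show "p i \<in> C i - {p i' |i'. i' \<in> {1..n} \<and> i' < i}"
      unfolding occ pi using spot_in[OF park i fin[OF i]] .
    fix j assume "j \<in> C i - {p i' |i'. i' \<in> {1..n} \<and> i' < i}"
    then show "p i \<le> j"
      unfolding occ pi spot_def using fin[OF i] by (intro Min_le) auto
  qed
  then show ?thesis by blast
qed

text \<open>Split by size: the \<open>l\<close>-subsets of \<open>B\<close> are among those of
  \<open>A\<close>, so discarding them subtracts one binomial coefficient from the other.\<close>

lemma card_subsets_not_within: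
  assumes "finite A" "B \<subseteq> A" "finite K"
  shows "int (card {S. S \<subseteq> A \<and> card S \<in> K \<and> \<not> S \<subseteq> B}) =
    (\<Sum>l\<in>K. int (card A choose l) - int (card B choose l))"
proof -
  have finB: "finite B" using assms(2,1) by (rule finite_subset)
  define F where "F l = {S. S \<subseteq> A \<and> card S = l} - {S. S \<subseteq> B \<and> card S = l}" for l
  have finA: "finite {S. S \<subseteq> A \<and> card S = l}" for l
    using assms(1) by (auto intro: finite_subset[of _ "Pow A"])
  have cF: "int (card (F l)) = int (card A choose l) - int (card B choose l)" for l
  proof -
    have sub: "{S. S \<subseteq> B \<and> card S = l} \<subseteq> {S. S \<subseteq> A \<and> card S = l}"
      using assms(2) by auto
    have "card (F l) = (card A choose l) - (card B choose l)"
      unfolding F_def using card_Diff_subset[OF finite_subset[OF sub finA] sub]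
      by (simp add: n_subsets assms(1) finB)
    moreover have "(card B choose l) \<le> (card A choose l)"
      using card_mono[OF finA sub] by (simp add: n_subsets assms(1) finB)
    ultimately show ?thesis by simp
  qed
  have "{S. S \<subseteq> A \<and> card S \<in> K \<and> \<not> S \<subseteq> B} = (\<Union>l\<in>K. F l)"
    by (auto simp: F_def)
  also have "card \<dots> = (\<Sum>l\<in>K. card (F l))"
    using finA by (intro card_UN_disjoint assms(3)) (auto simp: F_def)
  finally show ?thesis by (simp add: cF)
qed

text \<open>This is why the number of choices left to the next car does not depend on the earlier
  sets.\<close>

lemma card_occupied:
  assumes "all_park C m" "\<And>i. i \<in> {1..m} \<Longrightarrow> finite (C i)"
  shows "card (occupied C m) = m"
  using card_image[OF inj_on_spot[OF assms]] by (simp add: occupied_eq_spots)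

text \<open>Induction on the number \<open>m\<close> of cars, with the street \<open>{1..n}\<close>
  kept fixed: every admissible tuple for \<open>m\<close> cars has the same number of extensions to
  \<open>m + 1\<close> cars.\<close>

lemma card_all_park:
  assumes "m \<le> n" "\<And>i. i \<in> {1..n} \<Longrightarrow> finite (L i)"
  shows "int (card {C \<in> (\<Pi>\<^sub>E i\<in>{1..m}. {S. S \<subseteq> {1..n} \<and> card S \<in> L i}). all_park C m}) =
    (\<Prod>i=1..m. \<Sum>l\<in>L i. int (n choose l) - int ((i - 1) choose l))"
  using assms(1)
proof (induction m)
  case 0
  \<comment> \<open>The only extensional function on the empty domain; it matches the empty product
    1.\<close>
  have "{C \<in> (\<Pi>\<^sub>E i\<in>{1..0}. {S. S \<subseteq> {1..n} \<and> card S \<in> L i}). all_park C 0} = {\<lambda>_. undefined}"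
    by (auto simp: all_park_def)
  then show ?case by simp
next
  case (Suc m)
  define B where "B = (\<lambda>i. {S. S \<subseteq> {1..n} \<and> card S \<in> L i})"
  define G where "G k = {C \<in> Pi\<^sub>E {1..k} B. all_park C k}" for k
  define H where "H C = {S \<in> B (Suc m). \<not> S \<subseteq> occupied C m}" for C
  have finB: "finite (B i)" for i
    unfolding B_def by (rule finite_subset[of _ "Pow {1..n}"]) auto
  have finG: "finite (G m)"
    unfolding G_def by (rule finite_subset[of _ "Pi\<^sub>E {1..m} B"]) (auto intro!: finite_PiE finB)
  have upd_occ: "occupied (C(Suc m := S)) m = occupied C m" for C S
    by (rule occupied_cong) auto
  have upd_park: "all_park (C(Suc m := S)) m \<longleftrightarrow> all_park C m" for C S
    by (rule all_park_cong) auto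
  have Pi_Suc: "Pi\<^sub>E {1..Suc m} B = (\<lambda>(S, C). C(Suc m := S)) ` (B (Suc m) \<times> Pi\<^sub>E {1..m} B)"
    by (simp add: atLeastAtMostSuc_conv PiE_insert_eq)
  have upd_park_Suc:
    "all_park (C(Suc m := S)) (Suc m) \<longleftrightarrow> all_park C m \<and> \<not> S \<subseteq> occupied C m" for C S
    by (simp add: all_park_Suc upd_occ upd_park)
  \<comment> \<open>A dependent sum is required: the set \<open>H C\<close> of admissible last
    entries varies with \<open>C\<close>, and only its cardinality is constant.\<close>
  have G_Suc: "G (Suc m) = (\<lambda>(C, S). C(Suc m := S)) ` Sigma (G m) H"
  proof (intro equalityI subsetI)
    fix D assume "D \<in> G (Suc m)"
    then obtain C S where "D = C(Suc m := S)" "S \<in> B (Suc m)" "C \<in> Pi\<^sub>E {1..m} B"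
      "all_park D (Suc m)"
      unfolding G_def Pi_Suc by auto
    then show "D \<in> (\<lambda>(C, S). C(Suc m := S)) ` Sigma (G m) H"
      by (intro image_eqI[of _ _ "(C, S)"]) (simp_all add: G_def H_def upd_park_Suc)
  next
    fix D assume "D \<in> (\<lambda>(C, S). C(Suc m := S)) ` Sigma (G m) H"
    then obtain C S where D: "D = C(Suc m := S)" and CS: "C \<in> G m" "S \<in> H C"
      by auto
    then have "D \<in> Pi\<^sub>E {1..Suc m} B"
      unfolding Pi_Suc by (intro image_eqI[of _ _ "(S, C)"]) (simp_all add: G_def H_def)
    then show "D \<in> G (Suc m)"
      using D CS by (simp add: G_def H_def upd_park_Suc)
  qed
  have inj: "inj_on (\<lambda>(C, S). C(Suc m := S)) (Sigma (G m) H)"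
  proof (rule inj_onI, clarify)
    fix C S C' S' assume C: "C \<in> G m" "C' \<in> G m" and eq: "C(Suc m := S) = C'(Suc m := S')"
    \<comment> \<open>Extensionality fixes the overwritten value, so \<open>C\<close> can be
      recovered from \<open>C(Suc m := S)\<close>.\<close>
    have "C (Suc m) = undefined" "C' (Suc m) = undefined"
      using C by (auto simp: G_def PiE_def extensional_def)
    then have "C = C'"
      using eq by (metis fun_upd_triv fun_upd_upd)
    moreover have "S = S'"
      using eq by (metis fun_upd_same)
    ultimately show "C = C' \<and> S = S'" by simp
  qed
  define s where "s i = (\<Sum>l\<in>L i. int (n choose l) - int ((i - 1) choose l))" for i
  have cH: "int (card (H C)) = s (Suc m)" if C: "C \<in> G m" for C
  proof -
    have park: "all_park C m" and sub: "\<And>i. i \<in> {1..m} \<Longrightarrow> C i \<subseteq> {1..n}"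
      using C by (auto simp: G_def B_def PiE_def Pi_def)
    have fin: "\<And>i. i \<in> {1..m} \<Longrightarrow> finite (C i)"
      by (rule finite_subset[OF sub]) simp_all
    \<comment> \<open>Supplies the inclusion \<open>B \<subseteq> A\<close> of
      \<open>card_subsets_not_within\<close>, applied with
      \<open>card B = m = Suc m - 1\<close>.\<close>
    have "occupied C m \<subseteq> {1..n}"
      unfolding occupied_eq_spots using spot_in[OF park] fin sub by blast
    then have "int (card {S. S \<subseteq> {1..n} \<and> card S \<in> L (Suc m) \<and> \<not> S \<subseteq> occupied C m}) = s (Suc m)"
      using Suc.prems assms(2) card_occupied[OF park fin]
      by (subst card_subsets_not_within) (auto simp: s_def)
    then show ?thesis by (simp add: H_def B_def conj_assoc)
  qed
  have "int (card (G (Suc m))) = (\<Sum>C\<in>G m. int (card (H C)))"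
    unfolding G_Suc card_image[OF inj]
    using finG finB by (subst card_SigmaI) (auto simp: H_def)
  also have "\<dots> = int (card (G m)) * s (Suc m)"
    by (simp add: cH)
  also have "int (card (G m)) = (\<Prod>i=1..m. s i)"
    using Suc by (simp add: G_def B_def s_def)
  finally show ?case
    by (simp add: G_def B_def s_def)
qed

theorem theorem2p3:
  fixes n :: nat and L :: "nat \<Rightarrow> nat set"
  assumes "n \<ge> 1"
    and "\<And>i. i \<in> {1..n} \<Longrightarrow> L i \<subseteq> {1..n}"
  shows "int (SP n L) =
    (\<Prod>i=1..n. \<Sum>l\<in>L i. (int (n choose l) - int ((i - 1) choose l)))"
proof -
  \<comment> \<open>Eliminates the existential over outcomes, leaving the set counted by
    \<open>card_all_park\<close> at \<open>m = n\<close>.\<close>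
  have iff: "L_parking_function n L C \<longleftrightarrow>
      C \<in> (\<Pi>\<^sub>E i\<in>{1..n}. {S. S \<subseteq> {1..n} \<and> card S \<in> L i}) \<and> all_park C n" for C
  proof
    assume C: "L_parking_function n L C"
    then obtain \<pi> where out: "parking_outcome n C \<pi>" and tup: "C \<in> subset_tuples n"
      by (auto simp: L_parking_function_def subset_parking_function_def)
    have "C i \<subseteq> {1..n}" if "i \<in> {1..n}" for i
      using tup that by (auto simp: subset_tuples_def PiE_def Pi_def)
    then have "all_park C n"
      by (intro parking_outcome_imp_all_park[OF out] finite_subset[OF _ finite_atLeastAtMost])
    then show "C \<in> (\<Pi>\<^sub>E i\<in>{1..n}. {S. S \<subseteq> {1..n} \<and> card S \<in> L i}) \<and> all_park C n"
      using C tup by (auto simp: L_parking_function_def subset_tuples_def PiE_def Pi_def)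
  next
    assume C: "C \<in> (\<Pi>\<^sub>E i\<in>{1..n}. {S. S \<subseteq> {1..n} \<and> card S \<in> L i}) \<and> all_park C n"
    then have "\<exists>\<pi>. parking_outcome n C \<pi>"
      by (intro all_park_imp_parking_outcome) (auto simp: PiE_def Pi_def)
    \<comment> \<open>Demanded by \<open>subset_tuples\<close> but not by the product set; an empty
      \<open>C i\<close> would lie inside any occupied set.\<close>
    moreover have "\<forall>i\<in>{1..n}. C i \<noteq> {}"
      using C by (auto simp: all_park_def)
    ultimately show "L_parking_function n L C"
      using C by (auto simp: L_parking_function_def subset_parking_function_def
          subset_tuples_def PiE_def Pi_def)
  qed
  have "finite (L i)" if "i \<in> {1..n}" for i
    by (rule finite_subset[OF assms(2)[OF that]]) simp
  then show ?thesis
    unfolding SP_def iff by (intro card_all_park order.refl)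
qed

end
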